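(* Let $x$ be a non-ultimately periodic infinite word that contains no arbitrarily large squares. Then no suffix of $x$ admits a super-monochromatic factorisation for the 3-coloring $C$ of the factors of $x$ described in the context, i.e. there is no suffix $y=u_1u_2u_3\ldots$ of $x$ (nonempty finite $u_i$) such that all words $u_{n_1}\cdots u_{n_k}$ ($k\geq1$, $n_1<\cdots<n_k$) are factors of $x$ having the same $C$-color.
   Context: $x=x_0x_1\ldots$ contains no arbitrarily large squares: there is $M$ such that every factor of $x$ of the form $ww$ satisfies $|w|\leq M$. For a factor $u$ of $x$, $A(u)=\min\{k: u=x_k\cdots x_{k+|u|-1}\}$, $B(u)=A(u)+|u|$. A decomposition $u=v_1\cdots v_l$ ($v_i$ nonempty) is consecutive if $A(v_1)=A(u)$, $B(v_l)=B(u)$, $B(v_i)=A(v_{i+1})$; $L(u)$ is the maximal number of terms of such a decomposition; $v$ is irreducible if $L(v)=1$. For a factor $u$: $\lambda_+(u)$ (resp. $\lambda_-(u)$) is the set of irreducible factors $v$ of $x$ such that $vu$ is a factor of $x$ with $B(vu)=B(u)$ and $B(v)=A(u)$ (resp. $B(v)<A(u)$); $\rho_+(u)$ (resp. $\rho_-(u)$) is the set of irreducible suffixes $v$ of $u$ with $B(v)=A(u)$ (resp. $B(v)<A(u)$). The coloring $C$ on factors of $x$: if $L(u)=1$, $C(u)=\textbf{green}$; if $L(u)\geq2$, $C(u)=\textbf{red}$ when $\lambda_+(u)=\rho_+(u)$ and $\lambda_-(u)=\rho_-(u)$, and $C(u)=\textbf{blue}$ otherwise. Since $C$ is defined only on factors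 of $x$, a super-monochromatic factorisation requires every finite ordered concatenation to be a factor of $x$. *)

theory Defs
  imports "HOL-Library.Sublist" "HOL-Library.Omega_Words_Fun"
begin

text \<open>
  Finite words are lists and infinite words are functions on \<^typ>\<open>nat\<close>, over an
  arbitrary (not necessarily finite) alphabet. Every notion below is relative to
  an infinite word \<open>x\<close>.
\<close>

definition factor :: "'a word \<Rightarrow> 'a list \<Rightarrow> bool" where
  "factor x u \<longleftrightarrow> (\<exists>k. u = x [k \<rightarrow> k + length u])"

definition ultimately_periodic :: "'a word \<Rightarrow> bool" where
  "ultimately_periodic x \<longleftrightarrow> (\<exists>p q. q \<noteq> [] \<and> x = p \<frown> q\<^sup>\<omega>)"

definition no_large_squares :: "'a word \<Rightarrow> bool" where
  "no_large_squares x \<longleftrightarrow> (\<exists>M. \<forall>w. factor x (w @ w) \<longrightarrow> length w \<le> M)"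

text \<open>
  The values of \<open>first_start\<close> and \<open>first_end\<close> (written $A$ and $B$ in the literature)
  are only meaningful when \<open>u\<close> is a factor of \<open>x\<close>.
\<close>

definition first_start :: "'a word \<Rightarrow> 'a list \<Rightarrow> nat" where
  "first_start x u = (LEAST k. u = x [k \<rightarrow> k + length u])"

definition first_end :: "'a word \<Rightarrow> 'a list \<Rightarrow> nat" where
  "first_end x u = first_start x u + length u"

text \<open>
  The empty list of terms is admitted only as a decomposition of the empty word, which
  has no other one. Hence the empty word gets \<open>num_terms x [] = 0\<close> and is not irreducible.
  For a nonempty \<open>u\<close>, the maximum ranges over a set that contains 1 (from \<open>[u]\<close>) and is
  bounded by the length of \<open>u\<close>.
\<close>

definition consecutive_decomp :: "'a word \<Rightarrow> 'a list \<Rightarrow> 'a list list \<Rightarrow> bool" where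
  "consecutive_decomp x u vs \<longleftrightarrow>
     concat vs = u \<and> [] \<notin> set vs \<and>
     (vs \<noteq> [] \<longrightarrow> first_start x (hd vs) = first_start x u \<and>
                  first_end x (last vs) = first_end x u) \<and>
     (\<forall>i. Suc i < length vs \<longrightarrow> first_end x (vs ! i) = first_start x (vs ! Suc i))"

definition num_terms :: "'a word \<Rightarrow> 'a list \<Rightarrow> nat" where
  "num_terms x u = Max {length vs | vs. consecutive_decomp x u vs}"

definition irreducible_factor :: "'a word \<Rightarrow> 'a list \<Rightarrow> bool" where
  "irreducible_factor x v \<longleftrightarrow> factor x v \<and> num_terms x v = 1"

definition lambda_plus :: "'a word \<Rightarrow> 'a list \<Rightarrow> 'a list set" where
  "lambda_plus x u = {v. irreducible_factor x v \<and> factor x (v @ u) \<and>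
     first_end x (v @ u) = first_end x u \<and> first_end x v = first_start x u}"

definition lambda_minus :: "'a word \<Rightarrow> 'a list \<Rightarrow> 'a list set" where
  "lambda_minus x u = {v. irreducible_factor x v \<and> factor x (v @ u) \<and>
     first_end x (v @ u) = first_end x u \<and> first_end x v < first_start x u}"

definition rho_plus :: "'a word \<Rightarrow> 'a list \<Rightarrow> 'a list set" where
  "rho_plus x u = {v. irreducible_factor x v \<and> Sublist.suffix v u \<and>
     first_end x v = first_start x u}"

definition rho_minus :: "'a word \<Rightarrow> 'a list \<Rightarrow> 'a list set" where
  "rho_minus x u = {v. irreducible_factor x v \<and> Sublist.suffix v u \<and>
     first_end x v < first_start x u}"

datatype color = Green | Red | Blue

text \<open>The coloring is only meaningful on nonempty factors of \<open>x\<close>.\<close>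

definition coloring :: "'a word \<Rightarrow> 'a list \<Rightarrow> color" where
  "coloring x u =
     (if num_terms x u = 1 then Green
      else if lambda_plus x u = rho_plus x u \<and> lambda_minus x u = rho_minus x u then Red
      else Blue)"

text \<open>\<open>y\<close> is the infinite concatenation \<open>u 0 @ u 1 @ u 2 @ \<dots>\<close> of nonempty words.\<close>

definition factorisation :: "'a word \<Rightarrow> (nat \<Rightarrow> 'a list) \<Rightarrow> bool" where
  "factorisation y u \<longleftrightarrow>
     (\<forall>i. u i \<noteq> []) \<and>
     (\<forall>n. concat (map u [0..<n]) = Omega_Words_Fun.prefix (length (concat (map u [0..<n]))) y)"

definition super_monochromatic ::
  "'a word \<Rightarrow> ('a list \<Rightarrow> 'c) \<Rightarrow> (nat \<Rightarrow> 'a list) \<Rightarrow> bool" where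
  "super_monochromatic x c u \<longleftrightarrow>
     (\<exists>col. \<forall>ns. ns \<noteq> [] \<and> sorted_wrt (<) ns \<longrightarrow>
        factor x (concat (map u ns)) \<and> c (concat (map u ns)) = col)"

end

theory Submission
  imports Defs
begin

text \<open>
  Since \<open>x\<close> is not ultimately periodic, every long enough word read at a position \<open>a\<close> occurs
  there for the first time. So the factors of a super-monochromatic factorisation can be merged
  into blocks \<open>U i\<close>, each read at its first occurrence \<open>K i\<close>, which makes \<open>U 0 @ U 1\<close> reducible
  and excludes green.

  For \<open>i < j\<close> the word \<open>U i @ U j\<close> is therefore reducible. Wherever the cut lies, this forces the
  word to end at \<open>K (Suc j)\<close>, so \<open>U i\<close> is a suffix of every later block. If the blocks are long
  enough, then no irreducible word ending at \<open>K (Suc i)\<close> is longer than \<open>U i\<close>, and this makes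
  \<open>U (Suc i)\<close> red. Hence the common color is red.

  Finally let \<open>v\<close> be irreducible with \<open>B(v) = A(U i @ U (i+2))\<close>. By redness it is a suffix of
  \<open>U i @ U (i+2)\<close>. It is too new to be a suffix of \<open>U i\<close>, so it ends with \<open>U i\<close>, and since
  \<open>U i\<close> follows it, \<open>x\<close> contains the square of \<open>U i\<close>.
\<close>

section \<open>Occurrences, first occurrences and suffixes\<close>

definition occurs_at :: "'a word \<Rightarrow> 'a list \<Rightarrow> nat \<Rightarrow> bool" where
  "occurs_at x u k \<longleftrightarrow> u = x [k \<rightarrow> k + length u]"

lemma occurs_at_subsequence: "i \<le> j \<Longrightarrow> occurs_at x (x [i \<rightarrow> j]) i"
  by (simp add: occurs_at_def)

lemma subsequence_split:
  fixes x :: "'a word"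
  assumes "i \<le> j" "j \<le> k"
  shows "x [i \<rightarrow> k] = x [i \<rightarrow> j] @ x [j \<rightarrow> k]"
  using assms upt_add_eq_append[of i j "k - j"] by (simp add: subsequence_def flip: map_append)

lemma occurs_at_append:
  "occurs_at x (u @ v) k \<longleftrightarrow> occurs_at x u k \<and> occurs_at x v (k + length u)"
proof -
  have "x [k \<rightarrow> k + length (u @ v)] =
      x [k \<rightarrow> k + length u] @ x [k + length u \<rightarrow> k + length u + length v]"
    using subsequence_split[of k "k + length u" "k + length u + length v" x]
    by (simp add: add.assoc)
  then show ?thesis
    unfolding occurs_at_def by (simp add: append_eq_append_conv)
qed

lemma factor_iff_occurs_at: "factor x u \<longleftrightarrow> (\<exists>k. occurs_at x u k)"
  by (simp add: factor_def occurs_at_def)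

lemma first_start_le: "occurs_at x u k \<Longrightarrow> first_start x u \<le> k"
  unfolding first_start_def occurs_at_def by (rule Least_le)

lemma occurs_at_first_start: "factor x u \<Longrightarrow> occurs_at x u (first_start x u)"
  unfolding first_start_def factor_def occurs_at_def by (rule LeastI_ex)

lemma factor_appendD:
  assumes "factor x (u @ v)"
  shows "factor x u" "factor x v"
  using assms by (auto simp: factor_iff_occurs_at occurs_at_append)

lemma first_start_append_le:
  "factor x (u @ v) \<Longrightarrow> first_start x u \<le> first_start x (u @ v)"
  by (meson first_start_le occurs_at_append occurs_at_first_start)

lemma first_end_append_ge:
  assumes "factor x (u @ v)"
  shows "first_end x v \<le> first_end x (u @ v)"
  using first_start_le[of x v "first_start x (u @ v) + length u"] occurs_at_first_start[OF assms]
  by (simp add: occurs_at_append first_end_def)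

lemma first_end_suffix_le:
  assumes "factor x u" "Sublist.suffix v u"
  shows "first_end x v \<le> first_end x u"
  using assms first_end_append_ge by (auto simp: Sublist.suffix_def)

lemma occurs_at_suffix:
  assumes "occurs_at x u k" "Sublist.suffix v u" "l + length v = k + length u"
  shows "occurs_at x v l"
proof -
  obtain w where w: "u = w @ v" using assms(2) by (auto simp: Sublist.suffix_def)
  then have "l = k + length w" using assms(3) by simp
  then show ?thesis using assms(1) w by (simp add: occurs_at_append)
qed

lemma suffix_if_same_end:
  assumes "occurs_at x u k" "occurs_at x v l" "l + length v = k + length u" "length v \<le> length u"
  shows "Sublist.suffix v u"
proof -
  have "k \<le> l" "l \<le> k + length u" using assms(3,4) by auto
  then have "x [k \<rightarrow> k + length u] = x [k \<rightarrow> l] @ x [l \<rightarrow> l + length v]"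
    using assms(3) subsequence_split[of k l "k + length u" x] by simp
  then show ?thesis using assms(1,2) by (auto simp: Sublist.suffix_def occurs_at_def)
qed

section \<open>Decompositions and irreducible factors\<close>

lemma length_le_length_concat: "[] \<notin> set vs \<Longrightarrow> length vs \<le> length (concat vs)"
proof (induction vs)
  case (Cons v vs)
  then have "0 < length v" "length vs \<le> length (concat vs)" by auto
  then show ?case unfolding list.size concat.simps length_append by linarith
qed simp

lemma finite_decomp_lengths: "finite {length vs | vs. consecutive_decomp x u vs}"
proof (rule finite_subset)
  show "{length vs | vs. consecutive_decomp x u vs} \<subseteq> {..length u}"
    using length_le_length_concat unfolding consecutive_decomp_def by blast
qed simp

lemma num_terms_Nil: "num_terms x [] = 0"
proof -
  have "consecutive_decomp x [] vs \<longleftrightarrow> vs = []" for vs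
  proof
    assume "consecutive_decomp x [] vs"
    then have "concat vs = []" "[] \<notin> set vs" unfolding consecutive_decomp_def by blast+
    then show "vs = []" by (cases vs) auto
  qed (simp add: consecutive_decomp_def)
  then show ?thesis by (simp add: num_terms_def)
qed

text \<open>A consecutive decomposition into two terms. The condition that \<open>v\<close> ends
  where \<open>w\<close> starts is implied: both positions equal
  \<open>first_start x u + length v\<close>.\<close>

definition splits :: "'a word \<Rightarrow> 'a list \<Rightarrow> bool" where
  "splits x u \<longleftrightarrow> (\<exists>v w. u = v @ w \<and> v \<noteq> [] \<and> w \<noteq> [] \<and>
     first_start x v = first_start x u \<and> first_end x w = first_end x u)"

text \<open>Two terms suffice to detect reducibility, since all terms after the first can be merged.
  The merged word starts no earlier than the second term does and ends no later than
  \<open>u\<close> does, which fixes its first occurrence.\<close>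

lemma num_terms_eq_1_iff:
  assumes "factor x u" "u \<noteq> []"
  shows "num_terms x u = 1 \<longleftrightarrow> \<not> splits x u"
proof -
  let ?S = "{length vs | vs. consecutive_decomp x u vs}"
  have "consecutive_decomp x u [u]" using assms by (simp add: consecutive_decomp_def)
  then have one: "1 \<in> ?S" by force
  have "num_terms x u \<ge> 1"
    unfolding num_terms_def using finite_decomp_lengths one by (rule Max_ge)
  moreover have "num_terms x u \<ge> 2" if spl: "splits x u"
  proof -
    obtain v w where vw: "u = v @ w" "v \<noteq> []" "w \<noteq> []" "first_start x v = first_start x u"
      "first_end x w = first_end x u" using spl unfolding splits_def by blast
    then have "consecutive_decomp x u [v, w]"
      by (auto simp: consecutive_decomp_def first_end_def)
    then have "2 \<in> ?S" by force
    then show ?thesis unfolding num_terms_def by (rule Max_ge[OF finite_decomp_lengths])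
  qed
  moreover have "splits x u" if two: "num_terms x u \<ge> 2"
  proof -
    have "num_terms x u \<in> ?S"
      unfolding num_terms_def using finite_decomp_lengths one by (intro Max_in) auto
    then obtain vs where vs: "consecutive_decomp x u vs" "length vs \<ge> 2" using two by auto
    then obtain v w ws where eq: "vs = v # w # ws"
      by (auto simp: numeral_2_eq_2 Suc_le_length_iff)
    have "concat vs = u" "[] \<notin> set vs" "first_start x (hd vs) = first_start x u"
      "first_end x (vs ! 0) = first_start x (vs ! Suc 0)"
      using vs(1) eq unfolding consecutive_decomp_def by fastforce+
    then have u: "u = v @ w @ concat ws" and ne: "v \<noteq> []" "w \<noteq> []"
      and A: "first_start x v = first_start x u" and B: "first_end x v = first_start x w"
      unfolding eq by auto
    have "factor x (w @ concat ws)" using factor_appendD(2)[of x v] assms(1) u by simp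
    then have "first_start x w \<le> first_start x (w @ concat ws)"
      by (rule first_start_append_le)
    moreover have "first_end x (w @ concat ws) \<le> first_end x u"
      using assms(1) unfolding u by (rule first_end_append_ge)
    ultimately have "first_end x (w @ concat ws) = first_end x u"
      using A B u by (simp add: first_end_def)
    then show ?thesis using u ne A unfolding splits_def by blast
  qed
  ultimately show ?thesis by linarith
qed

lemma irreducible_factor_iff:
  "irreducible_factor x u \<longleftrightarrow> factor x u \<and> u \<noteq> [] \<and> \<not> splits x u"
  unfolding irreducible_factor_def
  by (cases "u = []") (use num_terms_eq_1_iff in \<open>auto simp: num_terms_Nil\<close>)

text \<open>Take the shortest nonempty word that ends at \<open>b\<close> and occurs there for the
  first time; the prefix of length \<open>b\<close> is a candidate. A split would yield a shorter
  one.\<close>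

lemma irreducible_factor_ending_at:
  assumes "0 < b"
  obtains v where "irreducible_factor x v" "first_end x v = b"
proof -
  define P where "P n \<longleftrightarrow> 0 < n \<and> n \<le> b \<and> first_start x (x [b - n \<rightarrow> b]) = b - n" for n
  have "P b" using first_start_le[OF occurs_at_subsequence[of 0 b x]] assms by (simp add: P_def)
  then obtain n where n: "P n" and least: "\<And>m. m < n \<Longrightarrow> \<not> P m"
    using exists_least_iff[of P] by blast
  define v where "v = x [b - n \<rightarrow> b]"
  have occ: "occurs_at x v (b - n)" unfolding v_def by (rule occurs_at_subsequence) simp
  have len: "length v = n" using n by (simp add: v_def P_def)
  have fs: "first_start x v = b - n" using n by (simp add: v_def P_def)
  have fe: "first_end x v = b" using n len fs by (simp add: first_end_def P_def)
  have "\<not> splits x v"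
  proof
    assume "splits x v"
    then obtain q r where qr: "v = q @ r" "q \<noteq> []" "r \<noteq> []" "first_end x r = b"
      by (auto simp: splits_def fe)
    have l: "length q + length r = n" using len qr(1) by simp
    have "0 < length q" "0 < length r" using qr by auto
    moreover have "occurs_at x r (b - length r)"
      by (rule occurs_at_suffix[OF occ]) (use qr(1) l n len in \<open>auto simp: P_def Sublist.suffix_def\<close>)
    then have "r = x [b - length r \<rightarrow> b]" using l n by (simp add: occurs_at_def P_def)
    ultimately have "P (length r)" using qr(4) l n by (auto simp: P_def first_end_def)
    then show False using least[of "length r"] l \<open>0 < length q\<close> by linarith
  qed
  moreover have "v \<noteq> []" using len n by (auto simp: P_def)
  ultimately have "irreducible_factor x v"
    using occ by (auto simp: irreducible_factor_iff factor_iff_occurs_at)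
  with fe show ?thesis by (rule that[rotated])
qed

section \<open>New words in a word that is not ultimately periodic\<close>

text \<open>Covering every \<open>c \<le> a\<close> lets the condition serve words that start before
  a block boundary as well as at it.\<close>

definition unrepeated_upto :: "'a word \<Rightarrow> nat \<Rightarrow> nat \<Rightarrow> bool" where
  "unrepeated_upto x a b \<longleftrightarrow> a < b \<and> (\<forall>c\<le>a. first_start x (x [c \<rightarrow> b]) = c)"

lemma ultimately_periodic_if_shift_eq:
  assumes "c < a" and eq: "\<And>d. x (c + d) = x (a + d)"
  shows "ultimately_periodic x"
proof -
  define q where "q = x [c \<rightarrow> a]"
  have len: "length q = a - c" "q \<noteq> []" using assms(1) by (auto simp: q_def)
  have "x (c + d) = q ! (d mod length q)" for d
  proof (induction d rule: less_induct)
    case (less d)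
    show ?case
    proof (cases "d < a - c")
      case True
      then show ?thesis using len by (simp add: q_def)
    next
      case False
      then have "x (c + d) = x (c + (d - (a - c)))"
        using eq[of "d - (a - c)"] assms(1) by (simp add: add.commute)
      also have "\<dots> = q ! ((d - (a - c)) mod length q)"
        using less.IH[of "d - (a - c)"] False assms(1) by linarith
      also have "\<dots> = q ! (d mod length q)"
        using False len by (simp add: le_mod_geq)
      finally show ?thesis .
    qed
  qed
  then have "suffix c x = q\<^sup>\<omega>" using len(2) by (simp add: fun_eq_iff iter_def)
  then have "x = Omega_Words_Fun.prefix c x \<frown> q\<^sup>\<omega>" by (metis prefix_suffix)
  then show ?thesis unfolding ultimately_periodic_def using len(2) by blast
qed

text \<open>Each of the finitely many earlier positions \<open>c\<close> starts a tail different
  from the one at \<open>a\<close>, and is ruled out once the word reaches an offset where the two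
  tails differ.\<close>

lemma eventually_unrepeated:
  assumes "\<not> ultimately_periodic x"
  shows "\<forall>\<^sub>F b in sequentially. first_start x (x [a \<rightarrow> b]) = a"
proof -
  have "\<forall>\<^sub>F b in sequentially. \<not> occurs_at x (x [a \<rightarrow> b]) c" if "c < a" for c
  proof -
    obtain d where d: "x (c + d) \<noteq> x (a + d)"
      using ultimately_periodic_if_shift_eq[OF \<open>c < a\<close>] assms by blast
    have "\<not> occurs_at x (x [a \<rightarrow> b]) c" if "a + d < b" for b
    proof
      assume "occurs_at x (x [a \<rightarrow> b]) c"
      then have "x [a \<rightarrow> b] ! d = x [c \<rightarrow> c + (b - a)] ! d" by (simp add: occurs_at_def)
      then show False using d that by simp
    qed
    then show ?thesis using eventually_gt_at_top[of "a + d"] by (rule eventually_mono[rotated])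
  qed
  then have "\<forall>\<^sub>F b in sequentially. \<forall>c\<in>{..<a}. \<not> occurs_at x (x [a \<rightarrow> b]) c"
    by (intro eventually_ball_finite) auto
  then show ?thesis using eventually_ge_at_top[of a]
  proof eventually_elim
    case (elim b)
    have occ: "occurs_at x (x [a \<rightarrow> b]) a" using elim(2) by (rule occurs_at_subsequence)
    then have "occurs_at x (x [a \<rightarrow> b]) (first_start x (x [a \<rightarrow> b]))"
      using occurs_at_first_start factor_iff_occurs_at by blast
    then show ?case using elim(1) first_start_le[OF occ] by (meson lessThan_iff le_neq_implies_less)
  qed
qed

lemma eventually_unrepeated_upto:
  assumes "\<not> ultimately_periodic x"
  shows "\<forall>\<^sub>F b in sequentially. unrepeated_upto x a b"
proof -
  have "\<forall>\<^sub>F b in sequentially. \<forall>c\<in>{..a}. first_start x (x [c \<rightarrow> b]) = c"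
    using eventually_unrepeated[OF assms] by (intro eventually_ball_finite) auto
  then show ?thesis using eventually_gt_at_top[of a]
    by eventually_elim (auto simp: unrepeated_upto_def)
qed

section \<open>Consequences of a common color for the blocks\<close>

text \<open>
  The intermediate position \<open>H i\<close> cuts every word that ends at \<open>K (Suc i)\<close> and starts before
  \<open>K i\<close> into two parts that are both new, so that such a word is reducible.
\<close>

locale monochromatic_blocks =
  fixes x :: "'a word" and K H :: "nat \<Rightarrow> nat" and col :: color
  assumes unrep_H: "unrepeated_upto x (K i) (H i)"
    and unrep_K: "unrepeated_upto x (H i) (K (Suc i))"
    and growth: "2 * K i \<le> K (Suc i)"
    and col_single: "coloring x (x [K i \<rightarrow> K (Suc i)]) = col"
    and factor_pair: "i < j \<Longrightarrow> factor x (x [K i \<rightarrow> K (Suc i)] @ x [K j \<rightarrow> K (Suc j)])"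
    and col_pair: "i < j \<Longrightarrow> coloring x (x [K i \<rightarrow> K (Suc i)] @ x [K j \<rightarrow> K (Suc j)]) = col"
begin

definition U :: "nat \<Rightarrow> 'a list" where
  "U i = x [K i \<rightarrow> K (Suc i)]"

lemma K_less_H: "K i < H i" and H_less_K: "H i < K (Suc i)"
  using unrep_H unrep_K by (auto simp: unrepeated_upto_def)

lemma K_less_K_Suc: "K i < K (Suc i)"
  using K_less_H H_less_K less_trans by blast

lemma K_mono: "i \<le> j \<Longrightarrow> K i \<le> K j"
  using lift_Suc_mono_le[of K] K_less_K_Suc less_imp_le by blast

lemma le_K: "i \<le> K i"
proof (induction i)
  case (Suc i)
  then show ?case using K_less_K_Suc[of i] by linarith
qed simp

lemma length_U: "length (U i) = K (Suc i) - K i"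
  by (simp add: U_def)

lemma K_add_length_U: "K i + length (U i) = K (Suc i)"
  using K_less_K_Suc[of i] by (simp add: length_U)

lemma U_nonempty: "U i \<noteq> []"
  using K_less_K_Suc[of i] by (simp add: U_def)

lemma occurs_at_U: "occurs_at x (U i) (K i)"
  unfolding U_def using K_less_K_Suc less_imp_le by (intro occurs_at_subsequence) blast

lemma factor_U: "factor x (U i)"
  using occurs_at_U factor_iff_occurs_at by blast

lemma first_start_U: "first_start x (U i) = K i"
  using unrep_K[of i] K_less_H[of i] by (simp add: unrepeated_upto_def U_def)

lemma first_end_U: "first_end x (U i) = K (Suc i)"
  by (simp add: first_end_def first_start_U K_add_length_U)

lemma first_start_U_append:
  assumes "occurs_at x (U i @ w) (K i)"
  shows "first_start x (U i @ w) = K i"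
proof -
  have "factor x (U i @ w)" using assms factor_iff_occurs_at by blast
  then show ?thesis
    using first_start_append_le first_start_le[OF assms] first_start_U by (metis antisym)
qed

lemma col_not_Green: "col \<noteq> Green"
proof -
  have occ: "occurs_at x (U 0 @ U 1) (K 0)"
    using occurs_at_U[of 0] occurs_at_U[of 1] by (simp add: occurs_at_append K_add_length_U)
  have "first_start x (U 0 @ U 1) = K 0" using occ by (rule first_start_U_append)
  moreover have "first_end x (U 0 @ U 1) = K 2"
    using calculation K_add_length_U[of 0] K_add_length_U[of 1]
    by (simp add: first_end_def numeral_2_eq_2)
  ultimately have "splits x (U 0 @ U 1)"
    unfolding splits_def using U_nonempty first_start_U first_end_U
    by (intro exI[of _ "U 0"] exI[of _ "U 1"]) (simp add: numeral_2_eq_2)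
  then have "num_terms x (U 0 @ U 1) \<noteq> 1"
    using num_terms_eq_1_iff U_nonempty occ factor_iff_occurs_at by (metis append_is_Nil_conv)
  then have "coloring x (U 0 @ U 1) \<noteq> Green" by (simp add: coloring_def)
  then show ?thesis using col_pair[of 0 1] by (simp add: U_def)
qed

text \<open>The end cannot come earlier, because \<open>U j\<close> is new. For the other bound,
  split the word into \<open>q @ r\<close>. If \<open>r\<close> lies within \<open>U j\<close>, it
  ends by \<open>K (Suc j)\<close>. Otherwise \<open>q\<close> is a prefix of \<open>U i\<close>, so
  the whole word starts by \<open>K i\<close> and its length is too small to pass
  \<open>K (Suc j)\<close>.\<close>

lemma first_end_U_U:
  assumes "i < j"
  shows "first_end x (U i @ U j) = K (Suc j)"
proof (rule antisym)
  let ?P = "U i @ U j"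
  have fac: "factor x ?P" using factor_pair[OF assms] by (simp add: U_def)
  show "K (Suc j) \<le> first_end x ?P"
    using first_end_append_ge[OF fac] by (simp add: first_end_U)
  have "num_terms x ?P \<noteq> 1"
    using col_pair[OF assms] col_not_Green by (auto simp: coloring_def U_def)
  then have "splits x ?P" using fac U_nonempty num_terms_eq_1_iff by (metis append_is_Nil_conv)
  then obtain q r where qr: "?P = q @ r" "first_start x q = first_start x ?P"
    "first_end x r = first_end x ?P" by (auto simp: splits_def)
  show "first_end x ?P \<le> K (Suc j)"
  proof (cases "length r \<le> length (U j)")
    case True
    then have "Sublist.suffix r (U j)"
      using suffix_length_suffix[of r ?P "U j"] by (simp add: qr(1)) (metis qr(1) suffixI)
    then show ?thesis using first_end_suffix_le[OF factor_U] qr(3) first_end_U by metis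
  next
    case False
    then have "length q \<le> length (U i)"
      using arg_cong[OF qr(1), of length] by simp
    then obtain s where s: "U i = q @ s"
      using qr(1) by (metis append_eq_append_conv_if append_take_drop_id)
    have "first_start x ?P \<le> K i"
      using first_start_append_le[of x q s] factor_U[of i] qr(2) s first_start_U by metis
    then have "first_end x ?P \<le> K (Suc i) + length (U j)"
      using K_add_length_U[of i] by (simp add: first_end_def)
    also have "\<dots> \<le> K j + length (U j)" using assms K_mono[of "Suc i" j] by simp
    finally show ?thesis by (simp add: K_add_length_U)
  qed
qed

text \<open>By \<open>growth\<close>, \<open>U j\<close> is at least as long as the whole prefix of
  \<open>x\<close> before it, which contains \<open>U i\<close>.\<close>

lemma length_U_le: "i < j \<Longrightarrow> length (U i) \<le> length (U j)"
  using K_mono[of "Suc i" j] growth[of j] by (simp add: length_U)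

text \<open>The pair first occurs with \<open>U j\<close> in its own place, so a copy of
  \<open>U i\<close> ends at \<open>K j\<close>.\<close>

lemma occurs_at_U_U:
  assumes "i < j"
  shows "occurs_at x (U i @ U j) (K j - length (U i))"
    and "first_start x (U i @ U j) = K j - length (U i)"
proof -
  show fs: "first_start x (U i @ U j) = K j - length (U i)"
    using first_end_U_U[OF assms] K_add_length_U[of j] by (simp add: first_end_def)
  show "occurs_at x (U i @ U j) (K j - length (U i))"
    using occurs_at_first_start[OF factor_pair[OF assms]] unfolding U_def[symmetric] fs .
qed

lemma length_U_le_K: "i < j \<Longrightarrow> length (U i) \<le> K j"
  using K_mono[of "Suc i" j] by (simp add: length_U)

lemma suffix_U:
  assumes "i < j"
  shows "Sublist.suffix (U i) (U j)"
proof (rule suffix_if_same_end[OF occurs_at_U])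
  \<comment> \<open>Pairing with \<open>Suc j\<close> instead of \<open>j\<close> puts a copy of
    \<open>U i\<close> right before \<open>K (Suc j)\<close>, where \<open>U j\<close> ends
    too.\<close>
  show "occurs_at x (U i) (K (Suc j) - length (U i))"
    using occurs_at_U_U(1)[of i "Suc j"] assms by (simp add: occurs_at_append)
qed (use assms length_U_le length_U_le_K[of i "Suc j"] K_add_length_U in auto)

lemma length_irreducible_le:
  assumes "irreducible_factor x v" "occurs_at x v b" "b + length v = K (Suc i)"
  shows "length v \<le> length (U i)"
proof (rule ccontr)
  assume "\<not> ?thesis"
  then have b: "b < K i" using assms(3) K_add_length_U[of i] by linarith
  note less = b K_less_H[of i] H_less_K[of i]
  have v: "v = x [b \<rightarrow> H i] @ x [H i \<rightarrow> K (Suc i)]"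
    using assms(2,3) less subsequence_split[of b "H i" "K (Suc i)" x] by (simp add: occurs_at_def)
  have fv: "factor x v" using assms(2) factor_iff_occurs_at by blast
  have q: "first_start x (x [b \<rightarrow> H i]) = b"
    using unrep_H[of i] b by (simp add: unrepeated_upto_def)
  \<comment> \<open>An earlier occurrence of \<open>v\<close> would give one of its prefix up to
    \<open>H i\<close>.\<close>
  have "b \<le> first_start x v" using first_start_append_le fv q v by metis
  then have fs: "first_start x v = b" using first_start_le[OF assms(2)] by simp
  moreover have "first_end x (x [H i \<rightarrow> K (Suc i)]) = K (Suc i)"
    using unrep_K[of i] less by (simp add: unrepeated_upto_def first_end_def)
  ultimately have "splits x v"
    unfolding splits_def using v q less assms(3)
    by (intro exI[of _ "x [b \<rightarrow> H i]"] exI[of _ "x [H i \<rightarrow> K (Suc i)]"]) (auto simp: first_end_def)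
  then show False using assms(1) by (simp add: irreducible_factor_iff)
qed

text \<open>Both sides amount to an occurrence of \<open>v\<close> that ends at
  \<open>K (Suc i)\<close>. The bound \<open>le\<close> covers the plus and minus sets
  together.\<close>

lemma preceding_iff_suffix:
  assumes irr: "irreducible_factor x v" and le: "first_end x v \<le> K (Suc i)"
  shows "factor x (v @ U (Suc i)) \<and> first_end x (v @ U (Suc i)) = first_end x (U (Suc i)) \<longleftrightarrow>
    Sublist.suffix v (U (Suc i))" (is "?L \<longleftrightarrow> ?R")
proof
  let ?P = "U (Suc i)"
  assume L: ?L
  then have e: "first_start x (v @ ?P) + length v = K (Suc i)"
    by (auto simp: first_end_def first_start_U)
  have occ: "occurs_at x v (first_start x (v @ ?P))"
    using L occurs_at_first_start occurs_at_append by blast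
  have "length v \<le> length (U i)" using irr occ e by (rule length_irreducible_le)
  then have "Sublist.suffix v (U i)"
    using suffix_if_same_end[OF occurs_at_U occ] e K_add_length_U by simp
  then show ?R using suffix_U[of i "Suc i"] suffix_order.trans by blast
next
  let ?P = "U (Suc i)"
  assume R: ?R
  have fv: "factor x v" using irr by (simp add: irreducible_factor_iff)
  \<comment> \<open>A short \<open>v\<close> is a suffix of \<open>U i\<close>, which ends at this
    position. A longer one ends with \<open>U i\<close>, so it cannot first end earlier, and
    \<open>le\<close> leaves only this position.\<close>
  have "\<exists>b. occurs_at x v b \<and> b + length v = K (Suc i)"
  proof (cases "length v \<le> length (U i)")
    case True
    then have "Sublist.suffix v (U i)"
      using R suffix_U[of i "Suc i"] suffix_length_suffix by blast
    moreover have "K (Suc i) - length v + length v = K i + length (U i)"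
      using True K_add_length_U[of i] by simp
    ultimately show ?thesis
      using occurs_at_suffix[OF occurs_at_U] K_add_length_U by metis
  next
    case False
    then have "Sublist.suffix (U i) v"
      using R suffix_U[of i "Suc i"] suffix_length_suffix[of "U i" ?P v] by simp
    then have "first_end x v = K (Suc i)"
      using first_end_suffix_le[OF fv] le first_end_U by (metis antisym)
    then show ?thesis using occurs_at_first_start[OF fv] by (auto simp: first_end_def)
  qed
  then obtain b where b: "occurs_at x v b" "b + length v = K (Suc i)" by blast
  have occ: "occurs_at x (v @ ?P) b" using b occurs_at_U by (simp add: occurs_at_append)
  then have fac: "factor x (v @ ?P)" using factor_iff_occurs_at by blast
  have "first_end x (v @ ?P) \<le> first_end x ?P"
    using first_start_le[OF occ] b(2) by (simp add: first_end_def first_start_U)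
  then show ?L using first_end_append_ge[OF fac] fac by simp
qed

lemma col_Red: "col = Red"
proof -
  \<comment> \<open>The first block with a predecessor, as \<open>preceding_iff_suffix\<close>
    requires.\<close>
  let ?P = "U 1"
  have "lambda_plus x ?P = rho_plus x ?P" "lambda_minus x ?P = rho_minus x ?P"
    unfolding lambda_plus_def rho_plus_def lambda_minus_def rho_minus_def
    using preceding_iff_suffix[of _ 0] by (auto simp: first_start_U intro: less_imp_le eq_refl)
  then have "coloring x ?P \<noteq> Blue" by (simp add: coloring_def)
  then show ?thesis using col_single[of 1] col_not_Green by (cases col) (auto simp: U_def)
qed

lemma square_U: "factor x (U (Suc i) @ U (Suc i))"
proof -
  \<comment> \<open>Skipping a block puts \<open>a\<close> beyond the end of \<open>U ?i\<close>, by
    a margin of at least \<open>K ?i\<close>. This is positive because \<open>?i\<close> is;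
    \<open>K 0\<close> may be 0.\<close>
  let ?i = "Suc i" and ?j = "Suc (Suc (Suc i))"
  define a where "a = K ?j - length (U ?i)"
  have "K (Suc ?i) < K ?j - length (U ?i)"
    using growth[of "Suc ?i"] K_less_K_Suc[of "?i"] le_K[of ?i] by (simp add: length_U)
  then have a: "K (Suc ?i) < a" by (simp add: a_def)
  then obtain v where v: "irreducible_factor x v" "first_end x v = a"
    using irreducible_factor_ending_at[of a x] by auto
  have fv: "factor x v" using v(1) by (simp add: irreducible_factor_iff)
  have occ: "occurs_at x (U ?i @ U ?j) a" and fs: "first_start x (U ?i @ U ?j) = a"
    using occurs_at_U_U[of ?i ?j] by (auto simp: a_def)
  have vocc: "occurs_at x v (first_start x v)" using fv by (rule occurs_at_first_start)
  have e: "first_start x v + length v = a" using v(2) by (simp add: first_end_def)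
  have vP: "occurs_at x (v @ U ?i @ U ?j) (first_start x v)"
    using vocc occ e by (simp add: occurs_at_append[of x v])
  then have fac: "factor x (v @ U ?i @ U ?j)" using factor_iff_occurs_at by blast
  have "first_end x (v @ U ?i @ U ?j) = first_end x (U ?i @ U ?j)"
    using first_end_append_ge[OF fac] first_start_le[OF vP] e fs by (simp add: first_end_def)
  \<comment> \<open>Reading \<open>v\<close> right before the first occurrence of the pair does not
    move the end of that occurrence.\<close>
  then have "v \<in> lambda_plus x (U ?i @ U ?j)"
    using v fac fs by (simp add: lambda_plus_def)
  moreover have "coloring x (U ?i @ U ?j) = Red"
    using col_pair[of ?i ?j] col_Red by (simp add: U_def)
  ultimately have "v \<in> rho_plus x (U ?i @ U ?j)"
    by (auto simp: coloring_def split: if_splits)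
  then have suf: "Sublist.suffix v (U ?i @ U ?j)" by (simp add: rho_plus_def)
  have sufU: "Sublist.suffix (U ?i) (U ?i @ U ?j)"
    using suffix_U[of ?i ?j] by (auto intro: suffix_appendI)
  have "\<not> Sublist.suffix v (U ?i)"
    using first_end_suffix_le[OF factor_U[of ?i], of v] v(2) a first_end_U[of ?i] by auto
  \<comment> \<open>Two suffixes of the same word are comparable.\<close>
  then have "Sublist.suffix (U ?i) v"
    using suf sufU suffix_same_cases by blast
  then obtain w where w: "v = w @ U ?i" by (auto simp: Sublist.suffix_def)
  have "factor x (w @ (U ?i @ U ?i) @ U ?j)" using fac w by simp
  then show ?thesis by (rule factor_appendD(1)[OF factor_appendD(2)])
qed

lemma arbitrarily_large_squares: "\<not> no_large_squares x"
proof
  assume "no_large_squares x"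
  then obtain M where M: "\<And>w. factor x (w @ w) \<Longrightarrow> length w \<le> M"
    by (auto simp: no_large_squares_def)
  have "length (U (Suc M)) \<le> M" using M square_U by blast
  \<comment> \<open>\<open>growth\<close> makes the length of \<open>U (Suc M)\<close> at least
    \<open>K (Suc M)\<close>, hence at least \<open>Suc M\<close>.\<close>
  then show False using growth[of "Suc M"] le_K[of "Suc M"] by (simp add: length_U)
qed

end

section \<open>Merging the factors of a factorisation into blocks\<close>

lemma concat_factorisation:
  assumes "factorisation (Omega_Words_Fun.suffix k x) u"
  obtains p where "strict_mono p" "\<And>i j. i \<le> j \<Longrightarrow> concat (map u [i..<j]) = x [p i \<rightarrow> p j]"
proof -
  \<comment> \<open>The position in \<open>x\<close>, not in its suffix, at which the factor
    \<open>u n\<close> starts.\<close>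
  define p where "p n = k + length (concat (map u [0..<n]))" for n
  have "u i \<noteq> []" for i
    using assms[unfolded factorisation_def, THEN conjunct1] ..
  then have mono: "strict_mono p" by (simp add: strict_mono_Suc_iff p_def)
  have pre: "concat (map u [0..<n]) = x [k \<rightarrow> p n]" for n
  proof -
    have "concat (map u [0..<n]) =
        Omega_Words_Fun.prefix (length (concat (map u [0..<n]))) (Omega_Words_Fun.suffix k x)"
      using assms[unfolded factorisation_def, THEN conjunct2] ..
    also have "\<dots> = x [k \<rightarrow> p n]" by (simp add: p_def)
    finally show ?thesis .
  qed
  have "concat (map u [i..<j]) = x [p i \<rightarrow> p j]" if "i \<le> j" for i j
  proof -
    have "k \<le> p i" "p i \<le> p j" using that mono by (simp_all add: strict_mono_less_eq) (simp add: p_def)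
    then have "x [k \<rightarrow> p i] @ x [p i \<rightarrow> p j] = x [k \<rightarrow> p j]"
      by (rule subsequence_split[symmetric])
    also have "\<dots> = concat (map u [0..<i]) @ concat (map u [i..<j])"
      unfolding pre[symmetric] using that upt_add_eq_append[of 0 i "j - i"] by simp
    finally show ?thesis unfolding pre by simp
  qed
  with mono show ?thesis by (rule that)
qed

theorem theorem5:
  fixes x :: "'a word"
  assumes "\<not> ultimately_periodic x"
    and "no_large_squares x"
  shows "\<not> (\<exists>k u. factorisation (Omega_Words_Fun.suffix k x) u \<and>
                 super_monochromatic x (coloring x) u)"
proof
  assume "\<exists>k u. factorisation (Omega_Words_Fun.suffix k x) u \<and> super_monochromatic x (coloring x) u"
  then obtain k u where fact: "factorisation (Omega_Words_Fun.suffix k x) u"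
    and mono: "super_monochromatic x (coloring x) u"
    by (elim exE conjE)
  from mono obtain col where "\<forall>ns. ns \<noteq> [] \<and> sorted_wrt (<) ns \<longrightarrow>
      factor x (concat (map u ns)) \<and> coloring x (concat (map u ns)) = col"
    unfolding super_monochromatic_def ..
  then have col: "factor x (concat (map u ns)) \<and> coloring x (concat (map u ns)) = col"
    if "ns \<noteq> []" "sorted_wrt (<) ns" for ns
    using that by simp
  obtain p where p: "strict_mono p"
    and concat_eq: "\<And>i j. i \<le> j \<Longrightarrow> concat (map u [i..<j]) = x [p i \<rightarrow> p j]"
    by (rule concat_factorisation[OF fact]) (rule that)
  \<comment> \<open>Block ends must be cuts of the factorisation for the color to be controlled; the
    intermediate \<open>h\<close> may be any position.\<close>
  let ?Q = "\<lambda>m n. (\<exists>h. unrepeated_upto x (p m) h \<and> unrepeated_upto x h (p n)) \<and> 2 * p m \<le> p n"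
  have "\<exists>n. ?Q m n" for m
  proof -
    obtain h where h: "unrepeated_upto x (p m) h"
      using eventually_happens'[OF sequentially_bot eventually_unrepeated_upto[OF assms(1)]] ..
    have "\<forall>\<^sub>F b in sequentially. unrepeated_upto x h b \<and> 2 * p m \<le> b"
      using eventually_unrepeated_upto[OF assms(1)] eventually_ge_at_top by (rule eventually_conj)
    then obtain N where N: "\<And>b. b \<ge> N \<Longrightarrow> unrepeated_upto x h b \<and> 2 * p m \<le> b"
      by (auto simp: eventually_sequentially)
    \<comment> \<open>Turns the bound \<open>N\<close> on positions into an admissible index of a
      cut.\<close>
    have "N \<le> p N" using p by (rule strict_mono_imp_increasing)
    then show ?thesis using N h by blast
  qed
  then have "\<exists>g. \<forall>i. True \<and> ?Q (g i) (g (Suc i))"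
    by (intro dependent_nat_choice) simp_all
  then obtain g where g: "\<And>i. ?Q (g i) (g (Suc i))" by auto
  then obtain H where H: "\<And>i. unrepeated_upto x (p (g i)) (H i)"
    "\<And>i. unrepeated_upto x (H i) (p (g (Suc i)))" by metis
  \<comment> \<open>Strictness comes from \<open>unrepeated_upto\<close>, which only holds for
    nonempty intervals.\<close>
  have "p (g i) < p (g (Suc i))" for i
    using H[of i] by (auto simp: unrepeated_upto_def)
  then have gi: "g i < g (Suc i)" for i using p by (simp add: strict_mono_less)
  have g_mono: "g i \<le> g j" if "i \<le> j" for i j
    using lift_Suc_mono_le[of g] gi less_imp_le that by blast
  have block: "concat (map u [g i..<g (Suc i)]) = x [p (g i) \<rightarrow> p (g (Suc i))]" for i
    using gi less_imp_le concat_eq by blast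
  \<comment> \<open>Two blocks with a possible gap between them still form an increasing list of
    indices. Here the super-monochromatic hypothesis goes beyond contiguous merging.\<close>
  have pair: "factor x (x [p (g i) \<rightarrow> p (g (Suc i))] @ x [p (g j) \<rightarrow> p (g (Suc j))]) \<and>
      coloring x (x [p (g i) \<rightarrow> p (g (Suc i))] @ x [p (g j) \<rightarrow> p (g (Suc j))]) = col"
    if "i < j" for i j
    using col[of "[g i..<g (Suc i)] @ [g j..<g (Suc j)]"] gi[of i] g_mono[of "Suc i" j] that
    by (auto simp: block sorted_wrt_append)
  have "monochromatic_blocks x (\<lambda>i. p (g i)) H col"
  proof
    show "coloring x (x [p (g i) \<rightarrow> p (g (Suc i))]) = col" for i
      using col[of "[g i..<g (Suc i)]"] gi[of i] by (auto simp: block)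
  qed (use H g pair in auto)
  then show False using monochromatic_blocks.arbitrarily_large_squares assms(2) by blast
qed

end
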